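(* Let $X,\widetilde X\in\mathbb{R}^{m\times N}$, $w\in\mathbb{R}^N$ and $\delta>0$. Run Qronos (with $\lambda=0$) with the deterministic round-to-nearest operator $\mathcal{Q}$ on $w$ using $X$ and $\widetilde X$, obtaining $q$. Then $$\|Xw-\widetilde Xq\|_2\le\big\|P_{\widetilde X_{\ge2}^{\perp}}P_{\widetilde X_1^{\perp}}(Xw-\widetilde Xw)\big\|_2+\frac{\delta}{2}\sqrt{N}\,\min\left\{\max_j\|P_{\widetilde X_{\ge j+1}^{\perp}}\widetilde X_j\|_2,\ \sqrt{\frac{\operatorname{Tr}(\widetilde X^\top\widetilde X)}{N}}\right\}.$$
   Context: Notation: for a matrix $A$ with columns $A_1,\dots,A_n$, $A_{\ge j}=(A_j,\dots,A_n)$; $P_{A^\perp}=I-AA^\dagger$ is the orthogonal projection onto the orthogonal complement of the column space of $A$ (equal to $I$ if $A$ has no columns), with $\dagger$ the pseudo-inverse. For a vector $v$, $v_{\ge j}=(v_j,\dots,v_n)^\top$. The alphabet is $\mathcal{A}=\mathcal{A}^\delta=\{k\delta:k\in\mathbb{Z}\}$ and $\mathcal{Q}(z)=\arg\min_{p\in\mathcal{A}}|z-p|$. Here $X$ is the calibration input of a layer from the original network and $\widetilde X$ that from the partially quantized network. Qronos with $\lambda=0$, in its least-squares form: set $w^{(0)}=w$ and, for $t=1,\dots,N$, $$q_t=\underset{p\in\mathcal{A}}{\arg\min}\ \tfrac12\Big\|Xw-\sum_{j=1}^{t-1}q_j\widetilde X_j-p\widetilde X_t-\sum_{j=t+1}^{N}w^{(t-1)}_j\widetilde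 X_j\Big\|_2^2,$$ $$w^{(t)}_{\ge t+1}=\underset{(v_{t+1},\dots,v_N)\in\mathbb{R}^{N-t}}{\arg\min}\ \tfrac12\Big\|Xw-\sum_{j=1}^{t}q_j\widetilde X_j-\sum_{j=t+1}^{N}v_j\widetilde X_j\Big\|_2^2.$$ The output is $q=(q_1,\dots,q_N)^\top$. (Equivalently, the algorithm is implemented with the Cholesky decomposition $(\widetilde X^\top\widetilde X)^{-1}=LL^\top$: $q_1=\mathcal{Q}\big(\widetilde X_1^\top(Xw-\widetilde X_{\ge2}w_{\ge2})/\|\widetilde X_1\|_2^2\big)$, $w^{(1)}_{\ge2}=\widetilde X_{\ge2}^{\dagger}(Xw-q_1\widetilde X_1)$, and for $t\ge2$, $q_t=\mathcal{Q}(w^{(t-1)}_t)$, $w^{(t)}_{\ge t+1}=w^{(t-1)}_{\ge t+1}-L_{\ge t+1,t}(w^{(t-1)}_t-q_t)/L_{tt}$.) *)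

theory Defs
  imports "Jordan_Normal_Form.Matrix" "HOL-Analysis.L2_Norm"
begin

text \<open>
  Indices start at 0: column \<open>j\<close> here is column \<open>j + 1\<close> in the usual one-based numbering, and
  \<open>cols_from A j\<close> consists of the columns \<open>j, j + 1, \<dots>\<close> of \<open>A\<close>.  If \<open>j = dim_col A\<close> this is a matrix
  without columns.
\<close>

definition cols_from :: "'a mat \<Rightarrow> nat \<Rightarrow> 'a mat" where
  "cols_from A j = mat (dim_row A) (dim_col A - j) (\<lambda>(i, k). A $$ (i, j + k))"

definition entries_from :: "'a vec \<Rightarrow> nat \<Rightarrow> 'a vec" where
  "entries_from v j = vec (dim_vec v - j) (\<lambda>k. v $ (j + k))"

definition norm2 :: "real vec \<Rightarrow> real" where
  "norm2 v = L2_set (\<lambda>i. v $ i) {0..<dim_vec v}"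

definition mat_trace :: "'a :: comm_monoid_add mat \<Rightarrow> 'a" where
  "mat_trace A = (\<Sum>i\<in>{0..<dim_row A}. A $$ (i, i))"

text \<open>The Moore--Penrose inverse, specified by the four Penrose equations.\<close>

definition is_pseudo_inverse :: "real mat \<Rightarrow> real mat \<Rightarrow> bool" where
  "is_pseudo_inverse A B \<longleftrightarrow>
     B \<in> carrier_mat (dim_col A) (dim_row A) \<and>
     A * B * A = A \<and> B * A * B = B \<and>
     transpose_mat (A * B) = A * B \<and> transpose_mat (B * A) = B * A"

definition pseudo_inverse :: "real mat \<Rightarrow> real mat" where
  "pseudo_inverse A = (THE B. is_pseudo_inverse A B)"

text \<open>
  \<open>I - A A\<^sup>\<dagger>\<close>.  If \<open>A\<close> has no columns, then \<open>A * pseudo_inverse A\<close> is the zero matrix of size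
  \<open>dim_row A\<close>, so this is the identity.
\<close>

definition perp_proj :: "real mat \<Rightarrow> real mat" where
  "perp_proj A = 1\<^sub>m (dim_row A) - A * pseudo_inverse A"

definition alphabet :: "real \<Rightarrow> real set" where
  "alphabet \<delta> = {of_int k * \<delta> | k :: int. True}"

text \<open>
  \<open>qronos_run \<delta> X Y w W q\<close>: \<open>q\<close> together with the intermediate weights \<open>W 0, \<dots>, W N\<close> is a run of
  Qronos without regularization, in its least-squares form; \<open>Y\<close> is the input from the partially
  quantized network.

  Step \<open>t\<close> (for \<open>t = 0, \<dots>, N - 1\<close>) first chooses \<open>q $ t\<close> and then \<open>W (Suc t)\<close>.  Neither minimizer
  need be unique: the first one may be tied (or arbitrary, if column \<open>t\<close> of \<open>Y\<close> vanishes), and the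
  second one is not unique if the columns of \<open>Y\<close> after \<open>t\<close> are linearly dependent.  Every choice of
  minimizers counts as a run, so in particular every deterministic tie-breaking rule for rounding to
  the nearest point of the alphabet is covered.  Only the entries of \<open>W t\<close> from index \<open>t\<close> onwards
  are meaningful; the others are unconstrained.
\<close>

definition qronos_run ::
    "real \<Rightarrow> real mat \<Rightarrow> real mat \<Rightarrow> real vec \<Rightarrow> (nat \<Rightarrow> real vec) \<Rightarrow> real vec \<Rightarrow> bool" where
  "qronos_run \<delta> X Y w W q \<longleftrightarrow>
     (let N = dim_col Y in
       q \<in> carrier_vec N \<and> (\<forall>t\<le>N. W t \<in> carrier_vec N) \<and> W 0 = w \<and>
       (\<forall>t<N.
          is_arg_min
            (\<lambda>p. 1 / 2 * (norm2
               (X *\<^sub>v w - finsum_vec TYPE(real) (dim_row Y) (\<lambda>j. q $ j \<cdot>\<^sub>v col Y j) {0..<t}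
                 - p \<cdot>\<^sub>v col Y t - cols_from Y (Suc t) *\<^sub>v entries_from (W t) (Suc t)))\<^sup>2)
            (\<lambda>p. p \<in> alphabet \<delta>)
            (q $ t) \<and>
          is_arg_min
            (\<lambda>v. 1 / 2 * (norm2
               (X *\<^sub>v w - finsum_vec TYPE(real) (dim_row Y) (\<lambda>j. q $ j \<cdot>\<^sub>v col Y j) {0..<Suc t}
                 - cols_from Y (Suc t) *\<^sub>v v))\<^sup>2)
            (\<lambda>v. v \<in> carrier_vec (N - Suc t))
            (entries_from (W (Suc t)) (Suc t))))"

definition qronos_output :: "real \<Rightarrow> real mat \<Rightarrow> real mat \<Rightarrow> real vec \<Rightarrow> real vec \<Rightarrow> bool" where
  "qronos_output \<delta> X Y w q \<longleftrightarrow> (\<exists>W. qronos_run \<delta> X Y w W q)"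

end

theory Submission
  imports Defs
begin

text \<open>
  Let \<open>y t\<close> be the columns of \<open>Xt\<close>, let \<open>b t\<close> be \<open>X w\<close> minus the sum of the \<open>q j \<cdot> y j\<close> with \<open>j < t\<close>, and
  let \<open>P t\<close> be the projection onto the orthogonal complement of the columns \<open>t, t + 1, \<dots>\<close> of \<open>Xt\<close>.  Since
  the weights \<open>W t\<close> solve a least-squares problem, the residual is \<open>e t = P t (b t)\<close> for \<open>t \<ge> 1\<close>, and
  \<open>e N = X w - Xt q\<close>.  For \<open>t \<ge> 1\<close>, \<open>e t\<close> is orthogonal to \<open>y t\<close>, so \<open>q t\<close> rounds the current weight
  \<open>s\<close> to within \<open>\<delta> / 2\<close>, and \<open>e (t + 1) = e t + (s - q t) P (t + 1) (y t)\<close> is an orthogonal sum.  At the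
  first step the residual is not yet orthogonal to \<open>y 0\<close> and only the triangle inequality is available:
  \<open>e 1\<close> is the sum of the vector in the first term of the bound and \<open>(s - q 0) P 1 (y 0)\<close>.  By induction,
  the norm of \<open>e t\<close> is at most that first term plus \<open>\<delta> / 2\<close> times the square root of the sum of the squares of
  \<open>a j = norm2 (P (j + 1) (y j))\<close> over \<open>j < t\<close>, and each \<open>a j\<close> is bounded both by the maximum and by the norm of
  \<open>y j\<close>.
\<close>

section \<open>Euclidean norm and orthogonality\<close>

lemma norm2_nonneg: "norm2 v \<ge> 0"
  by (simp add: norm2_def)

lemma norm2_sq: "(norm2 v)\<^sup>2 = v \<bullet> v"
  by (simp add: norm2_def L2_set_def scalar_prod_def sum_nonneg power2_eq_square)

lemma norm2_smult: "norm2 (a \<cdot>\<^sub>v v) = \<bar>a\<bar> * norm2 v"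
proof -
  have "(norm2 (a \<cdot>\<^sub>v v))\<^sup>2 = (\<bar>a\<bar> * norm2 v)\<^sup>2"
    by (simp add: norm2_sq power_mult_distrib) (simp add: power2_eq_square)
  then show ?thesis
    by (simp add: norm2_nonneg)
qed

lemma norm2_triangle:
  assumes "u \<in> carrier_vec n" "v \<in> carrier_vec n"
  shows "norm2 (u + v) \<le> norm2 u + norm2 v"
proof -
  have "norm2 (u + v) = L2_set (\<lambda>i. u $ i + v $ i) {0..<n}"
    unfolding norm2_def using assms by (intro L2_set_cong) auto
  with L2_set_triangle_ineq[of "\<lambda>i. u $ i" "\<lambda>i. v $ i" "{0..<n}"] show ?thesis
    using assms by (simp add: norm2_def)
qed

lemma norm2_sq_add_orthogonal:
  assumes "u \<in> carrier_vec n" "v \<in> carrier_vec n" "u \<bullet> v = 0"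
  shows "(norm2 (u + v))\<^sup>2 = (norm2 u)\<^sup>2 + (norm2 v)\<^sup>2"
  using assms comm_scalar_prod[of u n v]
  by (simp add: norm2_sq scalar_prod_add_distrib[of _ n] add_scalar_prod_distrib[of _ n])

lemma scalar_prod_self_eq_0:
  fixes v :: "real vec"
  assumes "v \<bullet> v = 0" "v \<in> carrier_vec n"
  shows "v = 0\<^sub>v n"
  using assms by (auto simp: scalar_prod_def sum_nonneg_eq_0_iff)

lemma transpose_mult_vec_eq_0_iff:
  fixes A :: "real mat"
  assumes "A \<in> carrier_mat m n" "x \<in> carrier_vec m"
  shows "transpose_mat A *\<^sub>v x = 0\<^sub>v n \<longleftrightarrow> (\<forall>j<n. col A j \<bullet> x = 0)"
  using assms by (auto simp: vec_eq_iff)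

lemma scalar_prod_mult_mat_vec:
  fixes A :: "real mat"
  assumes "A \<in> carrier_mat m n" "x \<in> carrier_vec m" "c \<in> carrier_vec n"
  shows "x \<bullet> (A *\<^sub>v c) = (transpose_mat A *\<^sub>v x) \<bullet> c"
proof -
  have "x \<bullet> (A *\<^sub>v c) = (A *\<^sub>v c) \<bullet> x"
    using assms by (intro comm_scalar_prod[of _ m]) auto
  also have "\<dots> = c \<bullet> (transpose_mat A *\<^sub>v x)"
    using transpose_vec_mult_scalar[of "transpose_mat A" n m x c] assms by simp
  also have "\<dots> = (transpose_mat A *\<^sub>v x) \<bullet> c"
    using assms by (intro comm_scalar_prod[of _ n]) auto
  finally show ?thesis .
qed

section \<open>The Moore--Penrose inverse\<close>

text \<open>One Gram-Schmidt step per column. The induction hypothesis is used for \<open>b\<close>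
  and also for the new column \<open>y n\<close>, which is why \<open>b\<close> is generalized.
  Families of functions replace matrices so that dropping the last column changes no
  dimension.\<close>

lemma normal_equations_solvable_sum:
  fixes y :: "nat \<Rightarrow> nat \<Rightarrow> real" and b :: "nat \<Rightarrow> real"
  shows "\<exists>c. \<forall>k<n. (\<Sum>i<m. y k i * (b i - (\<Sum>j<n. c j * y j i))) = 0"
proof (induction n arbitrary: b)
  case 0
  show ?case by simp
next
  case (Suc n)
  obtain c where c: "\<And>k. k < n \<Longrightarrow> (\<Sum>i<m. y k i * (b i - (\<Sum>j<n. c j * y j i))) = 0"
    using Suc.IH[of b] by blast
  obtain d where d: "\<And>k. k < n \<Longrightarrow> (\<Sum>i<m. y k i * (y n i - (\<Sum>j<n. d j * y j i))) = 0"
    using Suc.IH[of "y n"] by blast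
  define z where "z i = y n i - (\<Sum>j<n. d j * y j i)" for i
  define r where "r i = b i - (\<Sum>j<n. c j * y j i)" for i
  define s where "s = (\<Sum>i<m. z i * r i) / (\<Sum>i<m. z i * z i)"
  \<comment> \<open>These are the coefficients of the old solution plus \<open>s\<close> times
    \<open>z\<close>, with \<open>z\<close> expanded in the columns
    \<open>y 0, ..., y n\<close>.\<close>
  define c' where "c' j = (if j < n then c j - s * d j else s)" for j
  have res: "b i - (\<Sum>j<Suc n. c' j * y j i) = r i - s * z i" for i
    by (simp add: c'_def r_def z_def algebra_simps sum_subtractf sum_distrib_left)
  have lower: "(\<Sum>i<m. y k i * (r i - s * z i)) = 0" if "k < n" for k
  proof -
    have "(\<Sum>i<m. y k i * (r i - s * z i)) =
        (\<Sum>i<m. y k i * r i) - s * (\<Sum>i<m. y k i * z i)"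
      by (simp add: algebra_simps sum_subtractf sum_distrib_left)
    then show ?thesis
      using c[OF that] d[OF that] by (simp add: r_def z_def)
  qed
  \<comment> \<open>If \<open>z\<close> vanishes, the new column depends on the earlier ones;
    \<open>s\<close> is then 0 by the convention for division by zero, but any value would
    do.\<close>
  have z0: "(\<Sum>i<m. z i * (r i - s * z i)) = 0"
  proof (cases "(\<Sum>i<m. z i * z i) = 0")
    case True
    then have "\<forall>i<m. z i = 0"
      by (subst (asm) sum_nonneg_eq_0_iff) auto
    then show ?thesis by simp
  next
    case False
    have "(\<Sum>i<m. z i * (r i - s * z i)) = (\<Sum>i<m. z i * r i) - s * (\<Sum>i<m. z i * z i)"
      by (simp add: algebra_simps sum_subtractf sum_distrib_left)
    then show ?thesis using False by (simp add: s_def)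
  qed
  \<comment> \<open>Since \<open>y n\<close> is \<open>z\<close> plus a combination of earlier
    columns, orthogonality to \<open>z\<close> and to those columns gives orthogonality to
    \<open>y n\<close>.\<close>
  have "y n i * t = z i * t + (\<Sum>j<n. d j * (y j i * t))" for i t
    by (simp add: z_def left_diff_distrib sum_distrib_right mult.assoc)
  then have "(\<Sum>i<m. y n i * (r i - s * z i)) =
      (\<Sum>i<m. z i * (r i - s * z i)) + (\<Sum>i<m. \<Sum>j<n. d j * (y j i * (r i - s * z i)))"
    by (simp only: sum.distrib)
  also have "(\<Sum>i<m. \<Sum>j<n. d j * (y j i * (r i - s * z i))) =
      (\<Sum>j<n. d j * (\<Sum>i<m. y j i * (r i - s * z i)))"
    by (subst sum.swap) (simp add: sum_distrib_left)
  finally have top: "(\<Sum>i<m. y n i * (r i - s * z i)) = 0"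
    using z0 lower by simp
  show ?case
    by (intro exI[of _ c'] allI impI) (use res lower top in \<open>auto simp: less_Suc_eq\<close>)
qed

text \<open>Column \<open>l\<close> of \<open>H\<close> solves the least-squares problem whose
  right-hand side is the unit vector \<open>l\<close>.\<close>

lemma normal_equations_solvable:
  fixes A :: "real mat"
  assumes A: "A \<in> carrier_mat m n"
  shows "\<exists>H \<in> carrier_mat n m. transpose_mat A * (A * H) = transpose_mat A"
proof -
  have "\<forall>l. \<exists>c. \<forall>k<n. (\<Sum>i<m. A $$ (i, k) * ((if i = l then 1 else 0) - (\<Sum>j<n. c j * A $$ (i, j)))) = 0"
    by (intro allI normal_equations_solvable_sum[where y = "\<lambda>k i. A $$ (i, k)"])
  from choice[OF this] obtain c where "\<forall>l. \<forall>k<n.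
      (\<Sum>i<m. A $$ (i, k) * ((if i = l then 1 else 0) - (\<Sum>j<n. c l j * A $$ (i, j)))) = 0" ..
  then have c: "(\<Sum>i<m. A $$ (i, k) * ((if i = l then 1 else 0) - (\<Sum>j<n. c l j * A $$ (i, j)))) = 0"
    if "k < n" for k l
    using that by blast
  define H where "H = mat n m (\<lambda>(j, l). c l j)"
  have H: "H \<in> carrier_mat n m" by (simp add: H_def)
  have "transpose_mat A * (A * H) = transpose_mat A"
  proof (rule eq_matI)
    fix k l assume "k < dim_row (transpose_mat A)" "l < dim_col (transpose_mat A)"
    then have kl: "k < n" "l < m" using A by auto
    have "(transpose_mat A * (A * H)) $$ (k, l) =
        (\<Sum>i<m. A $$ (i, k) * (\<Sum>j<n. c l j * A $$ (i, j)))"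
      using A H kl
      by (simp add: scalar_prod_def H_def atLeast0LessThan mult.commute)
    also have "\<dots> = (\<Sum>i<m. A $$ (i, k) * (if i = l then 1 else 0))"
      using c[OF kl(1), of l] by (simp add: right_diff_distrib sum_subtractf)
    also have "\<dots> = transpose_mat A $$ (k, l)"
      using A kl by (simp add: if_distrib[where f = "\<lambda>x. _ * x"] cong: if_cong)
    finally show "(transpose_mat A * (A * H)) $$ (k, l) = transpose_mat A $$ (k, l)" .
  qed (use A H in auto)
  with H show ?thesis by blast
qed

text \<open>Multiplying the normal equations by the transpose of \<open>H\<close> shows that the
  transpose of \<open>A * H\<close> equals a Gram matrix, so \<open>A * H\<close> is symmetric.
  Transposing the normal equations then yields \<open>A * H * A = A\<close>.\<close>

lemma least_squares_inverse_exists: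
  fixes A :: "real mat"
  assumes A: "A \<in> carrier_mat m n"
  obtains H where "H \<in> carrier_mat n m" "A * H * A = A" "transpose_mat (A * H) = A * H"
proof -
  obtain H where H: "H \<in> carrier_mat n m" and N: "transpose_mat A * (A * H) = transpose_mat A"
    using normal_equations_solvable[OF A] by blast
  have AH: "A * H \<in> carrier_mat m m" using A H by simp
  have T: "transpose_mat (A * H) * (A * H) = transpose_mat (A * H)"
  proof -
    have "transpose_mat (A * H) * (A * H) = transpose_mat H * transpose_mat A * (A * H)"
      by (subst transpose_mult[OF A H]) simp
    also have "\<dots> = transpose_mat H * (transpose_mat A * (A * H))"
      by (rule assoc_mult_mat[of _ m n _ m _ m]) (use A H AH in auto)
    also have "\<dots> = transpose_mat (A * H)"
      by (simp only: N transpose_mult[OF A H])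
    finally show ?thesis .
  qed
  have sym: "transpose_mat (A * H) = A * H"
    using arg_cong[OF T, of transpose_mat] transpose_mult[of "transpose_mat (A * H)" m m "A * H" m] AH T
    by (simp add: transpose_transpose)
  have "transpose_mat (transpose_mat A * (A * H)) = transpose_mat (A * H) * A"
    using transpose_mult[of "transpose_mat A" n m "A * H" m] A AH by simp
  then have "A * H * A = A"
    by (simp add: N sym)
  with H sym show thesis using that by blast
qed

text \<open>A least-squares inverse \<open>H\<close> of \<open>A\<close> and the transpose
  \<open>K\<close> of one of the transposed matrix each satisfy half of the symmetry conditions;
  \<open>K * A * H\<close> inherits both, because \<open>A * B = A * H\<close> and
  \<open>B * A = K * A\<close>.\<close>

lemma pseudo_inverse_exists: "\<exists>B. is_pseudo_inverse A B"
proof -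
  define m where "m = dim_row A"
  define n where "n = dim_col A"
  have A: "A \<in> carrier_mat m n" by (simp add: m_def n_def)
  obtain H where H: "H \<in> carrier_mat n m" "A * H * A = A" "transpose_mat (A * H) = A * H"
    using least_squares_inverse_exists[OF A] by blast
  obtain K' where K': "K' \<in> carrier_mat m n" "transpose_mat A * K' * transpose_mat A = transpose_mat A"
    "transpose_mat (transpose_mat A * K') = transpose_mat A * K'"
    using least_squares_inverse_exists[of "transpose_mat A" n m] A by auto
  define K where "K = transpose_mat K'"
  have K: "K \<in> carrier_mat n m" using K' by (simp add: K_def)
  have KA: "transpose_mat A * K' = K * A"
    using K'(3) transpose_mult[of "transpose_mat A" n m K' n] A K'(1) by (simp add: K_def)
  have symK: "transpose_mat (K * A) = K * A" using K'(3) by (simp add: KA)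
  have "A * (K * A) = A"
    using arg_cong[OF K'(2), of transpose_mat] transpose_mult[of "K * A" n n "transpose_mat A" m] A K
    by (simp add: KA symK)
  then have AKA: "A * K * A = A" using A K by simp
  \<comment> \<open>\<open>A H\<close> and \<open>K A\<close> are the orthogonal projections onto the column space and the row space of \<open>A\<close>.\<close>
  define B where "B = K * A * H"
  have B: "B \<in> carrier_mat n m" using A H K by (simp add: B_def)
  have AB: "A * B = A * H"
  proof -
    have "A * B = A * K * A * H"
      unfolding B_def using A H(1) K
      by (smt (verit) assoc_mult_mat mult_carrier_mat)
    then show ?thesis by (simp add: AKA)
  qed
  have BA: "B * A = K * A"
  proof -
    have "B * A = K * (A * H * A)"
      unfolding B_def using A H(1) K
      by (smt (verit) assoc_mult_mat mult_carrier_mat)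
    then show ?thesis by (simp add: H)
  qed
  have BAB: "B * A * B = B"
  proof -
    have "B * A * B = K * (A * B)"
      unfolding BA using A B K by (simp add: assoc_mult_mat[of _ n m _ n])
    also have "\<dots> = B"
      unfolding AB unfolding B_def by (rule assoc_mult_mat[OF K A H(1), symmetric])
    finally show ?thesis .
  qed
  have "is_pseudo_inverse A B"
    unfolding is_pseudo_inverse_def using B H symK BAB
    by (simp add: AB BA m_def n_def)
  then show ?thesis by blast
qed

text \<open>The symmetric matrices \<open>A * B\<close> and \<open>A * C\<close> absorb each other,
  so transposing a product identifies them; likewise \<open>B * A\<close> and \<open>C * A\<close>.
  Then B = BAB = CAB = CAC = C.\<close>

lemma pseudo_inverse_unique:
  assumes "is_pseudo_inverse A B" "is_pseudo_inverse A C"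
  shows "B = C"
proof -
  define m where "m = dim_row A"
  define n where "n = dim_col A"
  have A: "A \<in> carrier_mat m n" by (simp add: m_def n_def)
  have B: "B \<in> carrier_mat n m" "A * B * A = A" "B * A * B = B"
      "transpose_mat (A * B) = A * B" "transpose_mat (B * A) = B * A"
    and C: "C \<in> carrier_mat n m" "A * C * A = A" "C * A * C = C"
      "transpose_mat (A * C) = A * C" "transpose_mat (C * A) = C * A"
    using assms by (auto simp: is_pseudo_inverse_def m_def n_def)
  have AB: "A * B \<in> carrier_mat m m" and AC: "A * C \<in> carrier_mat m m"
    and BA: "B * A \<in> carrier_mat n n" and CA: "C * A \<in> carrier_mat n n"
    using A B(1) C(1) by auto
  have 1: "(A * C) * (A * B) = A * B" and 2: "(A * B) * (A * C) = A * C"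
    using assoc_mult_mat[OF AC A B(1)] assoc_mult_mat[OF AB A C(1)] B(2) C(2) by simp_all
  have "A * B = transpose_mat ((A * C) * (A * B))" by (simp add: 1 B)
  also have "\<dots> = (A * B) * (A * C)" by (simp add: transpose_mult[OF AC AB] B C)
  finally have AB_AC: "A * B = A * C" by (simp add: 2)
  have 3: "(B * A) * (C * A) = B * A"
  proof -
    have "(B * A) * (C * A) = B * (A * (C * A))" by (rule assoc_mult_mat[OF B(1) A CA])
    then show ?thesis using assoc_mult_mat[OF A C(1) A] C(2) by simp
  qed
  have 4: "(C * A) * (B * A) = C * A"
  proof -
    have "(C * A) * (B * A) = C * (A * (B * A))" by (rule assoc_mult_mat[OF C(1) A BA])
    then show ?thesis using assoc_mult_mat[OF A B(1) A] B(2) by simp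
  qed
  have "B * A = transpose_mat ((B * A) * (C * A))" by (simp add: 3 B)
  also have "\<dots> = (C * A) * (B * A)" by (simp add: transpose_mult[OF BA CA] B C)
  finally have BA_CA: "B * A = C * A" by (simp add: 4)
  have "B = C * A * B" using B(3) by (simp add: BA_CA)
  also have "\<dots> = C * (A * B)" by (rule assoc_mult_mat[OF C(1) A B(1)])
  also have "\<dots> = C * A * C" unfolding AB_AC by (rule assoc_mult_mat[OF C(1) A C(1), symmetric])
  finally show ?thesis by (simp add: C)
qed

lemma pseudo_inverse_is_pseudo_inverse: "is_pseudo_inverse A (pseudo_inverse A)"
  unfolding pseudo_inverse_def
  using pseudo_inverse_exists[of A] pseudo_inverse_unique by (metis theI)

section \<open>Orthogonal projections and least squares\<close>

lemma perp_proj_carrier: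
  assumes "A \<in> carrier_mat m n"
  shows "perp_proj A \<in> carrier_mat m m"
  using assms pseudo_inverse_is_pseudo_inverse[of A]
  by (auto simp: perp_proj_def is_pseudo_inverse_def)

lemma perp_proj_mult_vec:
  assumes A: "A \<in> carrier_mat m n" and v: "v \<in> carrier_vec m"
  shows "perp_proj A *\<^sub>v v = v - A *\<^sub>v (pseudo_inverse A *\<^sub>v v)"
proof -
  have B: "pseudo_inverse A \<in> carrier_mat n m"
    using A pseudo_inverse_is_pseudo_inverse[of A] by (simp add: is_pseudo_inverse_def)
  have "perp_proj A *\<^sub>v v = 1\<^sub>m m *\<^sub>v v - (A * pseudo_inverse A) *\<^sub>v v"
    unfolding perp_proj_def using A B v
    by (subst minus_mult_distrib_mat_vec[of _ m m]) auto
  then show ?thesis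
    using v by (simp add: assoc_mult_mat_vec[OF A B v])
qed

text \<open>With \<open>B\<close> the pseudo-inverse, \<open>A * B\<close> fixes the column space
  because \<open>A * B * A = A\<close>, and, being symmetric, it kills whatever is orthogonal to the
  columns. Exhibiting an orthogonal decomposition thus determines a projection without computing
  \<open>B\<close>.\<close>

lemma perp_proj_eqI:
  assumes A: "A \<in> carrier_mat m n" and c: "c \<in> carrier_vec n" and z: "z \<in> carrier_vec m"
    and orth: "transpose_mat A *\<^sub>v z = 0\<^sub>v n"
  shows "perp_proj A *\<^sub>v (A *\<^sub>v c + z) = z"
proof -
  define B where "B = pseudo_inverse A"
  have B: "B \<in> carrier_mat n m" "A * B * A = A" "transpose_mat (A * B) = A * B"
    using A pseudo_inverse_is_pseudo_inverse[of A] by (auto simp: is_pseudo_inverse_def B_def)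
  have AB: "A * B \<in> carrier_mat m m" using A B by simp
  have 1: "A *\<^sub>v (B *\<^sub>v (A *\<^sub>v c)) = A *\<^sub>v c"
    using assoc_mult_mat_vec[OF A B(1), of "A *\<^sub>v c"] assoc_mult_mat_vec[OF AB A c] A c B(2) by simp
  have "A *\<^sub>v (B *\<^sub>v z) = transpose_mat (A * B) *\<^sub>v z"
    using assoc_mult_mat_vec[OF A B(1) z] by (simp add: B)
  also have "\<dots> = transpose_mat B *\<^sub>v (transpose_mat A *\<^sub>v z)"
    using assoc_mult_mat_vec[of "transpose_mat B" m n "transpose_mat A" m z] A B(1) z
    by (simp add: transpose_mult[OF A B(1)])
  also have "\<dots> = 0\<^sub>v m"
    unfolding orth using B(1) by (intro eq_vecI) auto
  finally have 2: "A *\<^sub>v (B *\<^sub>v z) = 0\<^sub>v m" .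
  have Ac: "A *\<^sub>v c \<in> carrier_vec m" using A c by simp
  have "A *\<^sub>v (B *\<^sub>v (A *\<^sub>v c + z)) = A *\<^sub>v c"
    using mult_add_distrib_mat_vec[OF B(1) Ac z]
      mult_add_distrib_mat_vec[OF A, of "B *\<^sub>v (A *\<^sub>v c)" "B *\<^sub>v z"] A B(1) c z Ac
    by (simp add: 1 2)
  then show ?thesis
    using perp_proj_mult_vec[OF A, of "A *\<^sub>v c + z"] Ac z A by (intro eq_vecI) (auto simp: B_def[symmetric])
qed

lemma transpose_mult_perp_proj:
  assumes A: "A \<in> carrier_mat m n" and v: "v \<in> carrier_vec m"
  shows "transpose_mat A *\<^sub>v (perp_proj A *\<^sub>v v) = 0\<^sub>v n"
proof -
  define B where "B = pseudo_inverse A"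
  have B: "B \<in> carrier_mat n m" "A * B * A = A" "transpose_mat (A * B) = A * B"
    using A pseudo_inverse_is_pseudo_inverse[of A] by (auto simp: is_pseudo_inverse_def B_def)
  have AB: "A * B \<in> carrier_mat m m" using A B by simp
  have "transpose_mat A * (A * B) = transpose_mat (A * B * A)"
    using transpose_mult[OF AB A] B(3) by simp
  then have "transpose_mat A *\<^sub>v (A *\<^sub>v (B *\<^sub>v v)) = transpose_mat A *\<^sub>v v"
    using assoc_mult_mat_vec[OF A B(1) v] assoc_mult_mat_vec[of "transpose_mat A" n m "A * B" m v]
      A AB v B(2) by simp
  then show ?thesis
    using perp_proj_mult_vec[OF A v] A B(1) v
      mult_minus_distrib_mat_vec[of "transpose_mat A" n m v "A *\<^sub>v (B *\<^sub>v v)"]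
    by (simp add: B_def[symmetric])
qed

text \<open>Pythagoras for the splitting of \<open>v\<close> into its projection and a vector in the
  column space.\<close>

lemma norm2_perp_proj_le:
  assumes A: "A \<in> carrier_mat m n" and v: "v \<in> carrier_vec m"
  shows "norm2 (perp_proj A *\<^sub>v v) \<le> norm2 v"
proof -
  let ?p = "perp_proj A *\<^sub>v v"
  let ?b = "A *\<^sub>v (pseudo_inverse A *\<^sub>v v)"
  have B: "pseudo_inverse A \<in> carrier_mat n m"
    using A pseudo_inverse_is_pseudo_inverse[of A] by (simp add: is_pseudo_inverse_def)
  have p: "?p \<in> carrier_vec m" and b: "?b \<in> carrier_vec m"
    using perp_proj_carrier[OF A] A B v by auto
  have v_eq: "v = ?p + ?b" using perp_proj_mult_vec[OF A v] v b A by (intro eq_vecI) auto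
  have "?p \<bullet> ?b = 0"
    using scalar_prod_mult_mat_vec[OF A p, of "pseudo_inverse A *\<^sub>v v"]
      transpose_mult_perp_proj[OF A v] B v by simp
  from norm2_sq_add_orthogonal[OF p b this]
  have "(norm2 v)\<^sup>2 = (norm2 ?p)\<^sup>2 + (norm2 ?b)\<^sup>2" by (simp only: v_eq[symmetric])
  then have "(norm2 ?p)\<^sup>2 \<le> (norm2 v)\<^sup>2" by simp
  then show ?thesis using norm2_nonneg power2_le_imp_le by blast
qed

text \<open>Moving \<open>x\<close> by \<open>e\<close> times the negative gradient \<open>z\<close>
  changes the squared residual norm by e^2 |Az|^2 - 2 e |z|^2. Minimality makes this nonnegative for
  every \<open>e\<close>, which forces \<open>z\<close> to vanish.\<close>

lemma least_squares_orthogonal: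
  assumes A: "A \<in> carrier_mat m n" and b: "b \<in> carrier_vec m"
    and min: "is_arg_min (\<lambda>v. 1 / 2 * (norm2 (b - A *\<^sub>v v))\<^sup>2) (\<lambda>v. v \<in> carrier_vec n) x"
  shows "transpose_mat A *\<^sub>v (b - A *\<^sub>v x) = 0\<^sub>v n"
proof -
  have x: "x \<in> carrier_vec n" using min by (simp add: is_arg_min_def)
  define r where "r = b - A *\<^sub>v x"
  define z where "z = transpose_mat A *\<^sub>v r"
  have r: "r \<in> carrier_vec m" and z: "z \<in> carrier_vec n"
    using A b x by (auto simp: r_def z_def)
  have Az: "A *\<^sub>v z \<in> carrier_vec m" using A z by simp
  have rAz: "r \<bullet> (A *\<^sub>v z) = z \<bullet> z"
    using scalar_prod_mult_mat_vec[OF A r z] by (simp add: z_def)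
  have ineq: "0 \<le> e * (e * ((A *\<^sub>v z) \<bullet> (A *\<^sub>v z)) - 2 * (z \<bullet> z))" for e
  proof -
    have eq: "b - A *\<^sub>v (x + e \<cdot>\<^sub>v z) = r - e \<cdot>\<^sub>v (A *\<^sub>v z)"
      using A b x z Az mult_add_distrib_mat_vec[OF A x, of "e \<cdot>\<^sub>v z"]
      by (auto simp: r_def mult_mat_vec[OF A z])
    have "(norm2 r)\<^sup>2 \<le> (norm2 (b - A *\<^sub>v (x + e \<cdot>\<^sub>v z)))\<^sup>2"
      using min x z unfolding is_arg_min_linorder r_def by auto
    also have "\<dots> = (r - e \<cdot>\<^sub>v (A *\<^sub>v z)) \<bullet> (r - e \<cdot>\<^sub>v (A *\<^sub>v z))"
      by (simp add: eq norm2_sq)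
    also have "\<dots> = r \<bullet> r - 2 * e * (z \<bullet> z) + e * e * ((A *\<^sub>v z) \<bullet> (A *\<^sub>v z))"
      using r Az rAz comm_scalar_prod[OF r Az]
      by (simp add: minus_scalar_prod_distrib[of _ m] scalar_prod_minus_distrib[of _ m] algebra_simps)
    finally show ?thesis by (simp add: norm2_sq algebra_simps)
  qed
  have quadratic: "a = 0" if "a \<ge> 0" "b \<ge> 0" "\<And>e. 0 \<le> e * (e * b - 2 * a)" for a b :: real
  proof (rule ccontr)
    assume "a \<noteq> 0"
    \<comment> \<open>The summand 1 keeps the denominator positive when \<open>b = 0\<close>; with
      this choice \<open>e * b - 2 * a\<close> equals \<open>- e - a\<close>, which is
      negative.\<close>
    define e where "e = a / (b + 1)"
    have "e > 0" using that(1,2) \<open>a \<noteq> 0\<close> by (simp add: e_def)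
    moreover have "e * b + e = a"
    proof -
      have "e * (b + 1) = a" using that(2) by (simp add: e_def)
      then show ?thesis by (simp add: distrib_left)
    qed
    ultimately have "e * (e * b - 2 * a) < 0"
      using that(1) by (intro mult_pos_neg) linarith+
    with that(3)[of e] show False by simp
  qed
  have "z \<bullet> z = 0"
    by (rule quadratic[OF _ _ ineq]) (metis norm2_sq zero_le_power2)+
  then show ?thesis using scalar_prod_self_eq_0[OF _ z] by (simp add: z_def r_def)
qed

lemma perp_proj_add_combination:
  assumes A: "A \<in> carrier_mat m n" and c: "c \<in> carrier_vec n"
    and d: "d \<in> carrier_vec m" and y: "y \<in> carrier_vec m"
  shows "perp_proj A *\<^sub>v (d + a \<cdot>\<^sub>v y + A *\<^sub>v c) =
    perp_proj A *\<^sub>v d + a \<cdot>\<^sub>v (perp_proj A *\<^sub>v y)"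
proof -
  have P: "perp_proj A \<in> carrier_mat m m" by (rule perp_proj_carrier[OF A])
  have Ac: "A *\<^sub>v c \<in> carrier_vec m" using A c by simp
  have "transpose_mat A *\<^sub>v 0\<^sub>v m = 0\<^sub>v n" using A by (intro eq_vecI) auto
  then have "perp_proj A *\<^sub>v (A *\<^sub>v c) = 0\<^sub>v m"
    using perp_proj_eqI[OF A c, of "0\<^sub>v m"] Ac by simp
  then show ?thesis
    using P Ac d y mult_add_distrib_mat_vec[OF P, of "d + a \<cdot>\<^sub>v y" "A *\<^sub>v c"]
      mult_add_distrib_mat_vec[OF P, of d "a \<cdot>\<^sub>v y"]
    by (simp add: mult_mat_vec[OF P y])
qed

section \<open>Qronos\<close>

lemma cols_from_carrier:
  "A \<in> carrier_mat m n \<Longrightarrow> cols_from A j \<in> carrier_mat m (n - j)"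
  by (auto simp: cols_from_def)

lemma col_cols_from:
  "j + k < dim_col A \<Longrightarrow> col (cols_from A j) k = col A (j + k)"
  by (auto simp: cols_from_def col_def)

lemma entries_from_carrier:
  "v \<in> carrier_vec n \<Longrightarrow> entries_from v j \<in> carrier_vec (n - j)"
  by (auto simp: entries_from_def)

lemma cols_from_mult_entries_from_0:
  assumes "A \<in> carrier_mat m n" "v \<in> carrier_vec n"
  shows "cols_from A 0 *\<^sub>v entries_from v 0 = A *\<^sub>v v"
proof -
  have "cols_from A 0 = A" using assms by (intro eq_matI) (auto simp: cols_from_def)
  moreover have "entries_from v 0 = v" using assms by (intro eq_vecI) (auto simp: entries_from_def)
  ultimately show ?thesis by simp
qed

lemma cols_from_mult_entries_from_Suc:
  fixes A :: "'a :: comm_semiring_0 mat"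
  assumes A: "A \<in> carrier_mat m n" and v: "v \<in> carrier_vec n" and t: "t < n"
  shows "cols_from A t *\<^sub>v entries_from v t =
    v $ t \<cdot>\<^sub>v col A t + cols_from A (Suc t) *\<^sub>v entries_from v (Suc t)"
proof (rule eq_vecI)
  fix i
  assume "i < dim_vec (v $ t \<cdot>\<^sub>v col A t + cols_from A (Suc t) *\<^sub>v entries_from v (Suc t))"
  then have i: "i < m" using A by (simp add: cols_from_def)
  have mult: "(cols_from A j *\<^sub>v entries_from v j) $ i = (\<Sum>k<n - j. A $$ (i, j + k) * v $ (j + k))" for j
    using A v i by (simp add: cols_from_def entries_from_def scalar_prod_def atLeast0LessThan)
  have "n - t = Suc (n - Suc t)" using t by simp
  then have "(\<Sum>k<n - t. A $$ (i, t + k) * v $ (t + k)) =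
      A $$ (i, t) * v $ t + (\<Sum>k<n - Suc t. A $$ (i, Suc t + k) * v $ (Suc t + k))"
    by (simp only: sum.lessThan_Suc_shift add_Suc_right add_Suc add_0_right)
  then show "(cols_from A t *\<^sub>v entries_from v t) $ i =
      (v $ t \<cdot>\<^sub>v col A t + cols_from A (Suc t) *\<^sub>v entries_from v (Suc t)) $ i"
    using mult[of t] mult[of "Suc t"] A i t cols_from_carrier[OF A, of "Suc t"]
    by (simp add: mult.commute)
qed (use A in \<open>auto simp: cols_from_def\<close>)

section \<open>Rounding to the alphabet\<close>

lemma alphabet_nearest:
  assumes "\<delta> > 0"
  obtains p where "p \<in> alphabet \<delta>" "\<bar>s - p\<bar> \<le> \<delta> / 2"
proof
  show "of_int (round (s / \<delta>)) * \<delta> \<in> alphabet \<delta>" by (auto simp: alphabet_def)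
  have "s - of_int (round (s / \<delta>)) * \<delta> = (s / \<delta> - of_int (round (s / \<delta>))) * \<delta>"
    using assms by (simp add: field_simps)
  then have "\<bar>s - of_int (round (s / \<delta>)) * \<delta>\<bar> = \<bar>of_int (round (s / \<delta>)) - s / \<delta>\<bar> * \<delta>"
    using assms by (simp add: abs_mult abs_minus_commute)
  then show "\<bar>s - of_int (round (s / \<delta>)) * \<delta>\<bar> \<le> \<delta> / 2"
    using of_int_round_abs_le[of "s / \<delta>"] assms by (simp add: mult_right_mono[of _ "1/2", simplified])
qed

text \<open>
  If \<open>y = 0\<close>, then \<open>q\<close> is an arbitrary point of the alphabet, but every \<open>s\<close>, in particular \<open>s = q\<close>,
  satisfies the conclusion.  This is why \<open>s\<close> is not given by a formula.
\<close>

lemma quantization_error: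
  assumes y: "y \<in> carrier_vec m" and u: "u \<in> carrier_vec m" and \<delta>: "\<delta> > 0"
    and min: "is_arg_min (\<lambda>p. 1 / 2 * (norm2 (u - p \<cdot>\<^sub>v y))\<^sup>2) (\<lambda>p. p \<in> alphabet \<delta>) q"
  obtains s where "\<bar>s - q\<bar> \<le> \<delta> / 2" "y \<bullet> (u - s \<cdot>\<^sub>v y) = 0"
proof (cases "y \<bullet> y = 0")
  case True
  then have "y = 0\<^sub>v m" using y by (rule scalar_prod_self_eq_0)
  then show thesis using that[of q] \<delta> u by simp
next
  case False
  define s where "s = (y \<bullet> u) / (y \<bullet> y)"
  have orth: "y \<bullet> (u - s \<cdot>\<^sub>v y) = 0"
    using y u False by (simp add: scalar_prod_minus_distrib[of _ m] s_def)
  \<comment> \<open>By Pythagoras the objective depends on \<open>p\<close> only through the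
    distance to \<open>s\<close>, so its minimizer over the alphabet is a nearest point to
    \<open>s\<close>.\<close>
  have sq: "(norm2 (u - p \<cdot>\<^sub>v y))\<^sup>2 = (norm2 (u - s \<cdot>\<^sub>v y))\<^sup>2 + (s - p)\<^sup>2 * (y \<bullet> y)" for p
  proof -
    have "u - p \<cdot>\<^sub>v y = (u - s \<cdot>\<^sub>v y) + (s - p) \<cdot>\<^sub>v y"
      using y u by (intro eq_vecI) (auto simp: algebra_simps)
    moreover have "(u - s \<cdot>\<^sub>v y) \<bullet> ((s - p) \<cdot>\<^sub>v y) = 0"
      using orth y u comm_scalar_prod[of "u - s \<cdot>\<^sub>v y" m y] by simp
    ultimately show ?thesis
      using norm2_sq_add_orthogonal[of "u - s \<cdot>\<^sub>v y" m "(s - p) \<cdot>\<^sub>v y"] y u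
      by (simp add: norm2_smult power_mult_distrib norm2_sq[of y])
  qed
  obtain p where p: "p \<in> alphabet \<delta>" "\<bar>s - p\<bar> \<le> \<delta> / 2" using alphabet_nearest[OF \<delta>] .
  have "(norm2 (u - q \<cdot>\<^sub>v y))\<^sup>2 \<le> (norm2 (u - p \<cdot>\<^sub>v y))\<^sup>2"
    using min p(1) by (auto simp: is_arg_min_linorder)
  then have "(s - q)\<^sup>2 * (y \<bullet> y) \<le> (s - p)\<^sup>2 * (y \<bullet> y)"
    unfolding sq[of q] sq[of p] by simp
  moreover have "y \<bullet> y > 0" using False zero_le_power2[of "norm2 y"] by (simp add: norm2_sq)
  ultimately have "\<bar>s - q\<bar> \<le> \<bar>s - p\<bar>" by (simp add: abs_le_square_iff)
  then show thesis using that[of s] p orth by simp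
qed

text \<open>Minkowski's inequality for the plane vectors (\<alpha>, 0) and (x, y). It carries the
  first-step term \<alpha> through the later orthogonal updates with coefficient 1.\<close>

lemma sqrt_add_sq_le:
  fixes \<alpha> x y :: real
  assumes "\<alpha> \<ge> 0" "x \<ge> 0"
  shows "sqrt ((\<alpha> + x)\<^sup>2 + y\<^sup>2) \<le> \<alpha> + sqrt (x\<^sup>2 + y\<^sup>2)"
proof (rule real_le_lsqrt)
  have "x \<le> sqrt (x\<^sup>2 + y\<^sup>2)" using assms by (simp add: real_le_rsqrt)
  then have "\<alpha> * x \<le> \<alpha> * sqrt (x\<^sup>2 + y\<^sup>2)" using assms by (intro mult_left_mono)
  then show "(\<alpha> + x)\<^sup>2 + y\<^sup>2 \<le> (\<alpha> + sqrt (x\<^sup>2 + y\<^sup>2))\<^sup>2"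
    by (simp add: power2_sum)
qed (use assms in auto)

theorem proposition5p3:
  fixes X Xt :: "real mat" and w q :: "real vec" and \<delta> :: real and m N :: nat
  assumes "N \<ge> 1"
    and "X \<in> carrier_mat m N" and "Xt \<in> carrier_mat m N" and "w \<in> carrier_vec N"
    and "\<delta> > 0"
    and "qronos_output \<delta> X Xt w q"
  shows "norm2 (X *\<^sub>v w - Xt *\<^sub>v q)
    \<le> norm2 (perp_proj (cols_from Xt 1) *\<^sub>v
              (perp_proj (mat_of_cols m [col Xt 0]) *\<^sub>v (X *\<^sub>v w - Xt *\<^sub>v w)))
      + \<delta> / 2 * sqrt (real N) *
        min (MAX j\<in>{0..<N}. norm2 (perp_proj (cols_from Xt (Suc j)) *\<^sub>v col Xt j))
            (sqrt (mat_trace (transpose_mat Xt * Xt) / real N))"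
proof -
  note X = assms(2) and Xt = assms(3) and w = assms(4) and \<delta> = assms(5)
  have dims: "dim_col Xt = N" "dim_row Xt = m" using Xt by auto
  obtain W where "qronos_run \<delta> X Xt w W q"
    using assms(6) by (auto simp: qronos_output_def)
  note run = this[unfolded qronos_run_def Let_def dims]
  from run have q: "q \<in> carrier_vec N" by (rule conjunct1)
  from run have W: "W t \<in> carrier_vec N" if "t \<le> N" for t using that by blast
  from run have W0: "W 0 = w" by (elim conjE)
  note minimizers = run[THEN conjunct2, THEN conjunct2, THEN conjunct2, rule_format]
  define S where "S t = finsum_vec TYPE(real) m (\<lambda>j. q $ j \<cdot>\<^sub>v col Xt j) {0..<t}" for t
  define A where "A = cols_from Xt"
  define y where "y t = col Xt t" for t
  define b where "b t = X *\<^sub>v w - S t" for t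
  define V where "V t = entries_from (W t)" for t
  define e where "e t = b t - A t *\<^sub>v V t t" for t
  define P where "P t = perp_proj (A t)" for t
  define a where "a t = norm2 (P (Suc t) *\<^sub>v y t)" for t
  define \<alpha> where "\<alpha> = norm2 (P 1 *\<^sub>v (perp_proj (mat_of_cols m [y 0]) *\<^sub>v (X *\<^sub>v w - Xt *\<^sub>v w)))"
  have A: "A t \<in> carrier_mat m (N - t)" for t
    using cols_from_carrier[OF Xt] by (simp add: A_def)
  then have dim_A [simp]: "dim_row (A t) = m" for t by blast
  have P: "P t \<in> carrier_mat m m" for t
    using perp_proj_carrier[OF A] by (simp add: P_def)
  have y: "y t \<in> carrier_vec m" for t using Xt by (auto simp: y_def)
  have V: "V t j \<in> carrier_vec (N - j)" if "t \<le> N" for t j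
    using entries_from_carrier[OF W[OF that]] by (simp add: V_def)
  have Xw: "X *\<^sub>v w \<in> carrier_vec m" and Xtw: "Xt *\<^sub>v w \<in> carrier_vec m" using X Xt w by auto
  have S: "S t \<in> carrier_vec m" for t
    unfolding S_def using y by (intro finsum_vec_closed) (auto simp: y_def)
  have S_idx: "S t $ i = (\<Sum>j<t. q $ j * y j $ i)" if "i < m" for t i
  proof -
    have "S t $ i = (\<Sum>j\<in>{0..<t}. (q $ j \<cdot>\<^sub>v col Xt j) $ i)"
      unfolding S_def using that y by (intro index_finsum_vec) (auto simp: y_def)
    also have "\<dots> = (\<Sum>j<t. q $ j * y j $ i)"
      using that dims by (intro sum.cong) (auto simp: y_def)
    finally show ?thesis .
  qed
  have b: "b t \<in> carrier_vec m" for t using Xw S by (simp add: b_def)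
  have b_Suc: "b (Suc t) = b t - q $ t \<cdot>\<^sub>v y t" for t
    using Xw S[of t] S[of "Suc t"] y[of t] by (intro eq_vecI) (auto simp: b_def S_idx)
  have AV: "A j *\<^sub>v V t j \<in> carrier_vec m" if "t \<le> N" for t j
    by (rule mult_mat_vec_carrier[OF A V[OF that]])
  have e: "e t \<in> carrier_vec m" if "t \<le> N" for t using b AV[OF that] by (simp add: e_def)
  have split: "A t *\<^sub>v V t t = W t $ t \<cdot>\<^sub>v y t + A (Suc t) *\<^sub>v V t (Suc t)" if "t < N" for t
    using cols_from_mult_entries_from_Suc[OF Xt W that] that by (simp add: A_def V_def y_def)
  \<comment> \<open>For \<open>t \<ge> 1\<close> the weights \<open>W t\<close> come from the second
    minimization of the preceding step. The initial weights \<open>W 0 = w\<close> carry no such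
    optimality, hence the restriction.\<close>
  have orth: "transpose_mat (A t) *\<^sub>v e t = 0\<^sub>v (N - t)" if "1 \<le> t" "t \<le> N" for t
  proof -
    obtain t' where t': "t = Suc t'" using \<open>1 \<le> t\<close> by (cases t) auto
    then have "is_arg_min (\<lambda>v. 1 / 2 * (norm2 (b t - A t *\<^sub>v v))\<^sup>2)
        (\<lambda>v. v \<in> carrier_vec (N - t)) (V t t)"
      using minimizers[of t', THEN conjunct2] that(2) unfolding b_def A_def V_def S_def by simp
    then show ?thesis
      unfolding e_def by (rule least_squares_orthogonal[OF A b])
  qed
  have e_proj: "e t = P t *\<^sub>v b t" if "1 \<le> t" "t \<le> N" for t
  proof -
    have "b t = A t *\<^sub>v V t t + e t"
      using b[of t] AV[OF that(2), of t] by (intro eq_vecI) (auto simp: e_def)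
    then show ?thesis
      using perp_proj_eqI[OF A V[OF that(2)] e[OF that(2)] orth[OF that]] by (simp add: P_def)
  qed
  \<comment> \<open>Common to all steps: \<open>d\<close> is what remains of \<open>b t\<close> when
    the later weights are kept and \<open>q t\<close> is replaced by an optimal real coefficient
    \<open>s\<close>. The projection \<open>P (Suc t)\<close> removes the combination of later
    columns.\<close>
  have step: "\<exists>s d. \<bar>s - q $ t\<bar> \<le> \<delta> / 2 \<and> d \<in> carrier_vec m \<and> y t \<bullet> d = 0 \<and>
      b t = d + s \<cdot>\<^sub>v y t + A (Suc t) *\<^sub>v V t (Suc t) \<and>
      e (Suc t) = P (Suc t) *\<^sub>v d + (s - q $ t) \<cdot>\<^sub>v (P (Suc t) *\<^sub>v y t)" if t: "t < N" for t
  proof -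
    note AV' = AV[OF less_imp_le[OF t], of "Suc t"]
    define u where "u = b t - A (Suc t) *\<^sub>v V t (Suc t)"
    have u: "u \<in> carrier_vec m" using b AV' by (simp add: u_def)
    have "X *\<^sub>v w - S t - p \<cdot>\<^sub>v y t - A (Suc t) *\<^sub>v V t (Suc t) = u - p \<cdot>\<^sub>v y t" for p
      unfolding b_def[symmetric] using b[of t] AV' y[of t] by (intro eq_vecI) (auto simp: u_def)
    moreover have "is_arg_min (\<lambda>p. 1 / 2 * (norm2
          (X *\<^sub>v w - S t - p \<cdot>\<^sub>v y t - A (Suc t) *\<^sub>v V t (Suc t)))\<^sup>2) (\<lambda>p. p \<in> alphabet \<delta>) (q $ t)"
      using minimizers[OF t, THEN conjunct1] unfolding S_def y_def A_def V_def .
    ultimately have "is_arg_min (\<lambda>p. 1 / 2 * (norm2 (u - p \<cdot>\<^sub>v y t))\<^sup>2) (\<lambda>p. p \<in> alphabet \<delta>) (q $ t)"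
      by simp
    then obtain s where s: "\<bar>s - q $ t\<bar> \<le> \<delta> / 2" "y t \<bullet> (u - s \<cdot>\<^sub>v y t) = 0"
      using quantization_error[OF y u \<delta>] by blast
    define d where "d = u - s \<cdot>\<^sub>v y t"
    have d: "d \<in> carrier_vec m" using u y by (simp add: d_def)
    have bt: "b t = d + s \<cdot>\<^sub>v y t + A (Suc t) *\<^sub>v V t (Suc t)"
      using b[of t] AV' y[of t] by (intro eq_vecI) (auto simp: d_def u_def)
    have "b (Suc t) = d + (s - q $ t) \<cdot>\<^sub>v y t + A (Suc t) *\<^sub>v V t (Suc t)"
      unfolding b_Suc bt using d AV' y[of t] by (intro eq_vecI) (auto simp: algebra_simps)
    then have "e (Suc t) = P (Suc t) *\<^sub>v d + (s - q $ t) \<cdot>\<^sub>v (P (Suc t) *\<^sub>v y t)"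
      using e_proj[of "Suc t"] t perp_proj_add_combination[OF A V[OF less_imp_le[OF t]] d y]
      by (simp add: P_def)
    with s d bt show ?thesis by (auto simp: d_def)
  qed
  have e_1: "norm2 (e 1) \<le> \<alpha> + \<delta> / 2 * a 0"
  proof -
    obtain s d where s: "\<bar>s - q $ 0\<bar> \<le> \<delta> / 2" and d: "d \<in> carrier_vec m" and yd: "y 0 \<bullet> d = 0"
      and b0: "b 0 = d + s \<cdot>\<^sub>v y 0 + A 1 *\<^sub>v V 0 1"
      and e1: "e 1 = P 1 *\<^sub>v d + (s - q $ 0) \<cdot>\<^sub>v (P 1 *\<^sub>v y 0)"
      using step[of 0] assms(1) by auto
    define M where "M = mat_of_cols m [y 0]"
    \<comment> \<open>Chosen so that \<open>X w - Xt w\<close> splits as \<open>M c + d\<close> with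
      \<open>d\<close> orthogonal to \<open>y 0\<close>; hence \<open>d\<close> is its projection,
      and \<alpha> is the norm of \<open>P 1 d\<close>.\<close>
    define c where "c = vec 1 (\<lambda>_. s - w $ 0)"
    have M: "M \<in> carrier_mat m 1" by (simp add: M_def mat_of_cols_def)
    have c: "c \<in> carrier_vec 1" by (simp add: c_def)
    have Mc: "M *\<^sub>v c = (s - w $ 0) \<cdot>\<^sub>v y 0"
      using y[of 0] by (intro eq_vecI) (auto simp: M_def c_def scalar_prod_def mat_of_cols_def)
    have "transpose_mat M *\<^sub>v d = 0\<^sub>v 1"
      using transpose_mult_vec_eq_0_iff[OF M d] yd y by (simp add: M_def)
    then have proj: "perp_proj M *\<^sub>v (M *\<^sub>v c + d) = d" by (rule perp_proj_eqI[OF M c d])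
    have "X *\<^sub>v w = b 0"
      using X Xw S[of 0] by (intro eq_vecI) (auto simp: b_def S_idx)
    moreover have "Xt *\<^sub>v w = w $ 0 \<cdot>\<^sub>v y 0 + A 1 *\<^sub>v V 0 1"
      using split[of 0] assms(1) cols_from_mult_entries_from_0[OF Xt w]
      by (simp add: A_def V_def W0)
    ultimately have "X *\<^sub>v w - Xt *\<^sub>v w = b 0 - (w $ 0 \<cdot>\<^sub>v y 0 + A 1 *\<^sub>v V 0 1)" by simp
    also have "\<dots> = M *\<^sub>v c + d"
      unfolding b0 Mc using d y[of 0] AV[of 0 1]
      by (intro eq_vecI) (auto simp: algebra_simps)
    finally have "X *\<^sub>v w - Xt *\<^sub>v w = M *\<^sub>v c + d" .
    with proj have \<alpha>: "\<alpha> = norm2 (P 1 *\<^sub>v d)" by (simp add: \<alpha>_def M_def)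
    have "norm2 (e 1) \<le> norm2 (P 1 *\<^sub>v d) + norm2 ((s - q $ 0) \<cdot>\<^sub>v (P 1 *\<^sub>v y 0))"
      unfolding e1 using P[of 1] d y by (intro norm2_triangle[of _ m]) auto
    also have "\<dots> \<le> \<alpha> + \<delta> / 2 * a 0"
      using mult_right_mono[OF s norm2_nonneg[of "P 1 *\<^sub>v y 0"]] by (simp add: \<alpha> norm2_smult a_def)
    finally show ?thesis .
  qed
  have e_Suc: "(norm2 (e (Suc t)))\<^sup>2 \<le> (norm2 (e t))\<^sup>2 + (\<delta> / 2 * a t)\<^sup>2" if t: "1 \<le> t" "t < N" for t
  proof -
    from t have tN: "t \<le> N" by simp
    obtain s d where s: "\<bar>s - q $ t\<bar> \<le> \<delta> / 2" and d: "d \<in> carrier_vec m" and yd: "y t \<bullet> d = 0"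
      and bt: "b t = d + s \<cdot>\<^sub>v y t + A (Suc t) *\<^sub>v V t (Suc t)"
      and eS: "e (Suc t) = P (Suc t) *\<^sub>v d + (s - q $ t) \<cdot>\<^sub>v (P (Suc t) *\<^sub>v y t)"
      using step[OF t(2)] by auto
    have cols: "y (t + k) \<bullet> e t = 0" if "k < N - t" for k
      using orth[OF t(1) tN] transpose_mult_vec_eq_0_iff[OF A e[OF tN]] that
        col_cols_from[of t k Xt] dims
      by (auto simp: A_def y_def)
    have orth': "transpose_mat (A (Suc t)) *\<^sub>v e t = 0\<^sub>v (N - Suc t)"
    proof -
      have "col (A (Suc t)) k \<bullet> e t = 0" if "k < N - Suc t" for k
        using cols[of "Suc k"] that col_cols_from[of "Suc t" k Xt] dims by (simp add: A_def y_def)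
      then show ?thesis using transpose_mult_vec_eq_0_iff[OF A e[OF tN]] by blast
    qed
    \<comment> \<open>Both \<open>e t\<close> and \<open>d\<close> subtract the same combination of
      later columns from \<open>b t\<close>, so they differ by a multiple of \<open>y t\<close>.
      Both are orthogonal to \<open>y t\<close>, so this multiple is zero as a vector, even when
      \<open>y t = 0\<close> and the coefficients disagree.\<close>
    have e_eq: "e t = d + (s - W t $ t) \<cdot>\<^sub>v y t"
      unfolding e_def split[OF t(2)] bt using d y[of t] AV[OF tN, of "Suc t"]
      by (intro eq_vecI) (auto simp: algebra_simps)
    have "(s - W t $ t) * (y t \<bullet> y t) = 0"
      using cols[of 0] t(2) y[of t] d yd by (simp add: e_eq scalar_prod_add_distrib[of _ m])
    then have "(s - W t $ t) \<cdot>\<^sub>v y t = 0\<^sub>v m"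
      using scalar_prod_self_eq_0[OF _ y[of t]] y[of t] by auto
    then have ed: "e t = d" using e_eq d by simp
    have Pd: "P (Suc t) *\<^sub>v d = e t"
    proof -
      have "A (Suc t) *\<^sub>v 0\<^sub>v (N - Suc t) = 0\<^sub>v m"
        using A[of "Suc t"] by (intro eq_vecI) auto
      then show ?thesis
        using perp_proj_eqI[OF A zero_carrier_vec e[OF tN] orth'] e[OF tN] by (simp add: P_def ed)
    qed
    let ?py = "P (Suc t) *\<^sub>v y t"
    have py: "?py \<in> carrier_vec m" by (rule mult_mat_vec_carrier[OF P y])
    \<comment> \<open>The vector \<open>?py\<close> is \<open>y t\<close> minus a combination of
      later columns, and \<open>e t\<close> is orthogonal to all of these.\<close>
    have "e t \<bullet> ?py = 0"
    proof -
      have pinv: "pseudo_inverse (A (Suc t)) *\<^sub>v y t \<in> carrier_vec (N - Suc t)"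
        using pseudo_inverse_is_pseudo_inverse[of "A (Suc t)"] A[of "Suc t"] y[of t]
        by (auto simp: is_pseudo_inverse_def)
      have "?py = y t - A (Suc t) *\<^sub>v (pseudo_inverse (A (Suc t)) *\<^sub>v y t)"
        unfolding P_def by (rule perp_proj_mult_vec[OF A y])
      moreover have "e t \<bullet> y t = 0"
        using yd comm_scalar_prod[OF d y] by (simp add: ed)
      moreover have "e t \<bullet> (A (Suc t) *\<^sub>v (pseudo_inverse (A (Suc t)) *\<^sub>v y t)) = 0"
        using scalar_prod_mult_mat_vec[OF A e[OF tN] pinv] pinv by (simp add: orth')
      ultimately show ?thesis
        using scalar_prod_minus_distrib[OF e[OF tN] y[of t] mult_mat_vec_carrier[OF A pinv]] by simp
    qed
    then have "(norm2 (e (Suc t)))\<^sup>2 = (norm2 (e t))\<^sup>2 + (norm2 ((s - q $ t) \<cdot>\<^sub>v ?py))\<^sup>2"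
      unfolding eS Pd using e[OF tN] py by (intro norm2_sq_add_orthogonal[of _ m]) auto
    also have "(norm2 ((s - q $ t) \<cdot>\<^sub>v ?py))\<^sup>2 \<le> (\<delta> / 2 * a t)\<^sup>2"
      using mult_right_mono[OF s norm2_nonneg[of ?py]]
      by (intro power_mono norm2_nonneg) (simp add: norm2_smult a_def)
    finally show ?thesis by simp
  qed
  have bound: "norm2 (e t) \<le> \<alpha> + \<delta> / 2 * sqrt (\<Sum>j<t. (a j)\<^sup>2)" if "1 \<le> t" "t \<le> N" for t
    using that
  proof (induction t rule: dec_induct)
    case base
    then show ?case using e_1 by (simp add: a_def norm2_nonneg)
  next
    case (step t)
    define x where "x = \<delta> / 2 * sqrt (\<Sum>j<t. (a j)\<^sup>2)"
    have x: "x \<ge> 0" "x\<^sup>2 = (\<delta> / 2)\<^sup>2 * (\<Sum>j<t. (a j)\<^sup>2)"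
      using \<delta> by (auto simp: x_def power_mult_distrib power_divide sum_nonneg)
    have "(norm2 (e (Suc t)))\<^sup>2 \<le> (norm2 (e t))\<^sup>2 + (\<delta> / 2 * a t)\<^sup>2"
      using e_Suc step.hyps step.prems by simp
    also have "\<dots> \<le> (\<alpha> + x)\<^sup>2 + (\<delta> / 2 * a t)\<^sup>2"
      using step by (simp add: x_def norm2_nonneg power_mono)
    finally have "norm2 (e (Suc t)) \<le> sqrt ((\<alpha> + x)\<^sup>2 + (\<delta> / 2 * a t)\<^sup>2)"
      by (rule real_le_rsqrt)
    also have "\<dots> \<le> \<alpha> + sqrt (x\<^sup>2 + (\<delta> / 2 * a t)\<^sup>2)"
      using x by (intro sqrt_add_sq_le) (auto simp: \<alpha>_def norm2_nonneg)
    also have "x\<^sup>2 + (\<delta> / 2 * a t)\<^sup>2 = (\<delta> / 2)\<^sup>2 * (\<Sum>j<Suc t. (a j)\<^sup>2)"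
      by (simp add: x(2) power_mult_distrib power_divide distrib_left)
    also have "sqrt \<dots> = \<delta> / 2 * sqrt (\<Sum>j<Suc t. (a j)\<^sup>2)"
      using \<delta> by (simp add: real_sqrt_mult)
    finally show ?case .
  qed
  have eN: "e N = X *\<^sub>v w - Xt *\<^sub>v q"
  proof -
    \<comment> \<open>After the last step no columns are left, so the product is an empty
      sum.\<close>
    have "A N *\<^sub>v V N N = 0\<^sub>v m"
      using A[of N] V[of N N] by (intro eq_vecI) (auto simp: scalar_prod_def)
    moreover have "S N = Xt *\<^sub>v q"
      using S[of N] dims q
      by (intro eq_vecI) (auto simp: S_idx scalar_prod_def y_def atLeast0LessThan mult.commute)
    ultimately show ?thesis using b[of N] by (simp add: e_def b_def)
  qed
  have le_max: "sqrt (\<Sum>j<N. (a j)\<^sup>2) \<le> sqrt (real N) * (MAX j\<in>{0..<N}. a j)"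
  proof -
    let ?M = "MAX j\<in>{0..<N}. a j"
    have aM: "a j \<le> ?M" if "j < N" for j using that by (intro Max_ge) auto
    have a0: "a j \<ge> 0" for j by (simp add: a_def norm2_nonneg)
    have "(\<Sum>j<N. (a j)\<^sup>2) \<le> (\<Sum>j<N. ?M\<^sup>2)"
      using aM a0 by (intro sum_mono power_mono) auto
    then have "sqrt (\<Sum>j<N. (a j)\<^sup>2) \<le> sqrt (real N * ?M\<^sup>2)" by simp
    \<comment> \<open>Needed to extract \<open>?M\<close> from the root of its square;
      \<open>N \<ge> 1\<close> provides the index 0.\<close>
    moreover have "?M \<ge> 0" using aM[of 0] a0[of 0] assms(1) by linarith
    ultimately show ?thesis by (simp add: real_sqrt_mult)
  qed
  have le_trace: "sqrt (\<Sum>j<N. (a j)\<^sup>2) \<le> sqrt (real N) * sqrt (mat_trace (transpose_mat Xt * Xt) / real N)"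
  proof -
    \<comment> \<open>Projections do not increase norms, and the trace of the Gram matrix is the sum
      of the squared column norms.\<close>
    have "(\<Sum>j<N. (a j)\<^sup>2) \<le> (\<Sum>j<N. (norm2 (y j))\<^sup>2)"
      unfolding a_def P_def
      by (intro sum_mono power_mono norm2_perp_proj_le[OF A y] norm2_nonneg)
    also have "\<dots> = mat_trace (transpose_mat Xt * Xt)"
      using dims by (simp add: mat_trace_def norm2_sq y_def atLeast0LessThan)
    finally show ?thesis using assms(1) by (simp add: real_sqrt_mult[symmetric])
  qed
  have "sqrt (\<Sum>j<N. (a j)\<^sup>2) \<le> sqrt (real N) *
      min (MAX j\<in>{0..<N}. a j) (sqrt (mat_trace (transpose_mat Xt * Xt) / real N))"
    using le_max le_trace by (simp add: min_def)
  then have "\<delta> / 2 * sqrt (\<Sum>j<N. (a j)\<^sup>2) \<le> \<delta> / 2 * (sqrt (real N) *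
      min (MAX j\<in>{0..<N}. a j) (sqrt (mat_trace (transpose_mat Xt * Xt) / real N)))"
    using \<delta> by (intro mult_left_mono) auto
  with bound[of N] assms(1) show ?thesis
    by (simp add: eN \<alpha>_def a_def P_def A_def y_def mult.assoc)
qed

end
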